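(* Let $\mathcal C$ be a closed and convex subset of $\mathbb{R}^n$. Let $F:\mathbb{R}^n\rightrightarrows\mathbb{R}^m$ with $\mathcal C\subset\mathrm{dom}\,F$, let $\bar x\in\mathcal C$ and $\bar y\in F(\bar x)$. Assume that $F$ has a locally closed graph around $(\bar x,\bar y)$. Then $F$ has the Aubin property with respect to $\mathcal C$ around $(\bar x,\bar y)$ if and only if the following inequality holds for any $\kappa\ge\mathfrak{a}_{\mathcal C}F(\bar x,\bar y)$: $$\Vert x^*\Vert\le\kappa\Vert y^*\Vert\quad\forall x^*\in D^*_{\mathcal C}F(\bar x,\bar y)(y^* ).$$ Consequently, $F$ has the Aubin property with respect to $\mathcal C$ around $(\bar x,\bar y)$ if and only if $D^*_{\mathcal C}F(\bar x,\bar y)(0)=\{0\}$. Moreover, the exact constant can be computed by $$\mathfrak{a}_{\mathcal C}F(\bar x,\bar y)=\Vert D^*_{\mathcal C}F(\bar x,\bar y)\Vert:=\sup\left\{\Vert x^*\Vert\mid y^*\in\mathbb{B},\ x^*\in D^*_{\mathcal C}F(\bar x,\bar y)(y^* )\right\}.$$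
   Context: All spaces are finite-dimensional Euclidean, with $\Vert(x,y)\Vert=\sqrt{\Vert x\Vert^2+\Vert y\Vert^2}$ on products; $\mathbb{B}$ is the closed unit ball. A set $S$ is locally closed around $z\in S$ if its intersection with every sufficiently small closed ball centered at $z$ is closed. For a set $S$, $\Pi(x,S)=\{u\in S\mid\Vert u-x\Vert=\inf_{v\in S}\Vert v-x\Vert\}$. For a set-valued mapping $F$, $\mathrm{dom}\,F=\{x\mid F(x)\ne\emptyset\}$ and $\mathrm{gph}\,F=\{(x,y)\mid y\in F(x)\}$; $F_{\mathcal C}(x)=F(x)$ if $x\in\mathcal C$ and $F_{\mathcal C}(x)=\emptyset$ otherwise. For $\mathcal C\subset\mathbb{R}^n$ nonempty and closed, $F$ has the Aubin property with respect to $\mathcal C$ around $(\bar x,\bar y)\in\mathrm{gph}\,F$ if $\mathrm{gph}\,F$ is locally closed around $(\bar x,\bar y)$ and there exist $\kappa\ge0$ and neighborhoods $V$ of $\bar y$ and $U$ of $\bar x$ such that $$F(u)\cap V\subset F(x)+\kappa\Vert u-x\Vert\mathbb{B}\quad\forall x,u\in\mathcal C\cap U.$$ The exact constant $\mathfrak{a}_{\mathcal C}F(\bar x,\bar y)$ is the infimum of all constants $\kappa$ for which such neighborhoods exist. For a closed convex set $\mathcal K$ and $z\in\Omega\cap\mathcal K$, with $\Omega$ locally closed around $z$: the proximal normal cone $N^p_{\mathcal K}(z,\Omega)$ to $\Omega$ at $z$ with respect to $\mathcal K$ is the set of $z^*$ for which there is $t>0$ with $z+tz^*\in\mathcal K$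 and $z\in\Pi(z+tz^*,\Omega\cap\mathcal K)$. The limiting normal cone $N_{\mathcal K}(z,\Omega)$ to $\Omega$ at $z$ with respect to $\mathcal K$ is the set of all limits $z^*=\lim z_k^*$ with $z_k^*\in N^p_{\mathcal K}(z_k,\Omega)$, $z_k\in\Omega\cap\mathcal K$, $z_k\to z$. For a nonempty closed set $\mathcal C\subset\mathrm{dom}\,F$ (here also convex) with $\bar x\in\mathcal C$, the limiting coderivative with respect to $\mathcal C$ of $F$ at $(\bar x,\bar y)\in\mathrm{gph}\,F$ is the multifunction $D^*_{\mathcal C}F(\bar x,\bar y):\mathbb{R}^m\rightrightarrows\mathbb{R}^n$ given by $$D^*_{\mathcal C}F(\bar x,\bar y)(y^* )=\{x^*\in\mathbb{R}^n\mid(x^*,-y^* )\in N_{\mathcal C\times\mathbb{R}^m}((\bar x,\bar y),\mathrm{gph}\,F_{\mathcal C})\},\quad y^*\in\mathbb{R}^m.$$ *)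

theory Defs
  imports "HOL-Analysis.Analysis"
begin

definition svdom :: "('a \<Rightarrow> 'b set) \<Rightarrow> 'a set" where
  "svdom F = {x. F x \<noteq> {}}"

definition gph :: "('a \<Rightarrow> 'b set) \<Rightarrow> ('a \<times> 'b) set" where
  "gph F = {(x, y). y \<in> F x}"

definition svrestrict :: "('a \<Rightarrow> 'b set) \<Rightarrow> 'a set \<Rightarrow> 'a \<Rightarrow> 'b set" where
  "svrestrict F C x = (if x \<in> C then F x else {})"

definition locally_closed_around :: "'a::euclidean_space set \<Rightarrow> 'a \<Rightarrow> bool" where
  "locally_closed_around S z \<longleftrightarrow>
     z \<in> S \<and> (\<exists>\<epsilon>>0. \<forall>r. 0 < r \<and> r \<le> \<epsilon> \<longrightarrow> closed (S \<inter> cball z r))"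

definition proj_set :: "'a::euclidean_space \<Rightarrow> 'a set \<Rightarrow> 'a set" where
  "proj_set x S = {u \<in> S. norm (u - x) = (INF v\<in>S. norm (v - x))}"

text \<open>The closed unit ball is \<open>cball 0 1\<close>; a neighborhood of a point is any set, not necessarily
  open, that has the point in its interior.\<close>

definition aubin_constant ::
  "'a::euclidean_space set \<Rightarrow> ('a \<Rightarrow> 'b::euclidean_space set) \<Rightarrow> 'a \<Rightarrow> 'b \<Rightarrow> real \<Rightarrow> bool" where
  "aubin_constant C F xb yb \<kappa> \<longleftrightarrow>
     0 \<le> \<kappa> \<and>
     (\<exists>U V. xb \<in> interior U \<and> yb \<in> interior V \<and>
        (\<forall>x \<in> C \<inter> U. \<forall>u \<in> C \<inter> U.
           F u \<inter> V \<subseteq> {y + (\<kappa> * norm (u - x)) *\<^sub>R b | y b. y \<in> F x \<and> b \<in> cball 0 1}))"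

definition aubin_property ::
  "'a::euclidean_space set \<Rightarrow> ('a \<Rightarrow> 'b::euclidean_space set) \<Rightarrow> 'a \<Rightarrow> 'b \<Rightarrow> bool" where
  "aubin_property C F xb yb \<longleftrightarrow>
     locally_closed_around (gph F) (xb, yb) \<and> (\<exists>\<kappa>. aubin_constant C F xb yb \<kappa>)"

text \<open>Extended-real valued, so that the value is \<open>\<infinity>\<close> when there is no constant at all.\<close>

definition aubin_exact ::
  "'a::euclidean_space set \<Rightarrow> ('a \<Rightarrow> 'b::euclidean_space set) \<Rightarrow> 'a \<Rightarrow> 'b \<Rightarrow> ereal" where
  "aubin_exact C F xb yb = Inf {ereal \<kappa> | \<kappa>. aubin_constant C F xb yb \<kappa>}"

text \<open>In the next two definitions the first argument is the convex set with respect to which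
  normals to \<open>\<Omega>\<close> are taken. Membership of the base point in \<open>\<Omega> \<inter> K\<close> is part of \<open>proj_set\<close>.\<close>

definition prox_normal_cone ::
  "'a::euclidean_space set \<Rightarrow> 'a \<Rightarrow> 'a set \<Rightarrow> 'a set" where
  "prox_normal_cone K z \<Omega> =
     {zs. \<exists>t>0. z + t *\<^sub>R zs \<in> K \<and> z \<in> proj_set (z + t *\<^sub>R zs) (\<Omega> \<inter> K)}"

definition lim_normal_cone ::
  "'a::euclidean_space set \<Rightarrow> 'a \<Rightarrow> 'a set \<Rightarrow> 'a set" where
  "lim_normal_cone K z \<Omega> =
     {zs. \<exists>w ws. (\<forall>k. w k \<in> \<Omega> \<inter> K \<and> ws k \<in> prox_normal_cone K (w k) \<Omega>) \<and>
                 w \<longlonglongrightarrow> z \<and> ws \<longlonglongrightarrow> zs}"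

definition lim_coderivative ::
  "'a::euclidean_space set \<Rightarrow> ('a \<Rightarrow> 'b::euclidean_space set) \<Rightarrow> 'a \<Rightarrow> 'b \<Rightarrow> 'b \<Rightarrow> 'a set" where
  "lim_coderivative C F xb yb ys =
     {xs. (xs, - ys) \<in> lim_normal_cone (C \<times> UNIV) (xb, yb) (gph (svrestrict F C))}"

definition sv_norm :: "('b::euclidean_space \<Rightarrow> 'a::euclidean_space set) \<Rightarrow> ereal" where
  "sv_norm D = Sup {ereal (norm xs) | xs ys. ys \<in> cball 0 1 \<and> xs \<in> D ys}"

end

theory Submission
  imports Defs
begin

text \<open>Everything rests on two facts. First, every Aubin constant \<open>\<kappa>\<close> bounds the coderivative:
  \<open>norm xs \<le> \<kappa> * norm ys\<close> for \<open>xs\<close> in its value at \<open>ys\<close>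
  (\<open>aubin_constant_coderivative_bound\<close>). For a proximal normal \<open>(xs, - ys)\<close> at \<open>(u, v)\<close> this comes
  from moving \<open>u\<close> a little in the direction \<open>xs\<close>, which stays inside the convex set \<open>C\<close>, and
  inserting the graph point that the Aubin property provides there into the inequality that says that
  \<open>(u, v)\<close> is a projection. The bound survives limits.

  Conversely, if near \<open>(xb, yb)\<close> every proximal normal has \<open>norm xs < \<alpha> * norm ys\<close> unless it is
  horizontally zero, then every \<open>\<kappa> > \<alpha>\<close> is an Aubin constant
  (\<open>aubin_constant_if_no_steep_prox_normal\<close>). Given \<open>y \<in> F u\<close> and \<open>x \<in> C\<close>, minimise
  \<open>\<alpha> * norm (u' - x) + norm (v' - y)\<close>, with the second norm smoothed, over graph points
  \<open>(u', v')\<close> close to \<open>(xb, yb)\<close>. A minimiser with \<open>u' \<noteq> x\<close> would carry a proximal normal whose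
  horizontal part has norm \<open>\<alpha>\<close> and whose vertical part has norm at most one. Hence \<open>u' = x\<close>, and the
  minimal value bounds the distance from \<open>y\<close> to \<open>v' \<in> F x\<close>. Local closedness of the graph
  and finite dimension give an exact minimiser. This matters: the perturbation term of a variational
  principle would add to the normal a horizontal vector that need not point into \<open>C\<close>, while the
  exact minimiser has a normal pointing from \<open>u'\<close> towards \<open>x \<in> C\<close>.

  Both converse statements follow by compactness (\<open>steep_coderivative_if_not_aubin_constant\<close>): if
  Aubin constants fail, normalised steep proximal normals accumulate at an element of the
  coderivative. When a single \<open>\<kappa> > \<alpha>\<close> fails, that element shows that the norm of the coderivative
  is at least \<open>\<alpha>\<close>. When all constants fail, it is a nonzero element of the value at zero.\<close>

section \<open>Normals with respect to a convex set\<close>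

lemma proj_set_iff:
  "u \<in> proj_set x S \<longleftrightarrow> u \<in> S \<and> (\<forall>v\<in>S. norm (u - x) \<le> norm (v - x))"
proof -
  have bdd: "bdd_below ((\<lambda>v. norm (v - x)) ` S)"
    by (rule bdd_belowI[of _ 0]) auto
  show ?thesis
  proof (intro iffI conjI ballI)
    fix v assume u: "u \<in> proj_set x S" and v: "v \<in> S"
    have "(INF v\<in>S. norm (v - x)) \<le> norm (v - x)"
      by (rule cINF_lower[OF bdd v])
    then show "norm (u - x) \<le> norm (v - x)"
      using u by (simp add: proj_set_def)
  next
    assume u: "u \<in> S \<and> (\<forall>v\<in>S. norm (u - x) \<le> norm (v - x))"
    have "(INF v\<in>S. norm (v - x)) = norm (u - x)"
      by (rule cInf_eq_minimum) (use u in auto)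
    then show "u \<in> proj_set x S"
      using u by (simp add: proj_set_def)
  qed (auto simp: proj_set_def)
qed

lemma norm_le_norm_diff_iff:
  fixes a d :: "'a::real_inner"
  shows "norm a \<le> norm (d - a) \<longleftrightarrow> 2 * (a \<bullet> d) \<le> (norm d)\<^sup>2"
proof -
  have "norm a \<le> norm (d - a) \<longleftrightarrow> (norm a)\<^sup>2 \<le> (norm (d - a))\<^sup>2"
    by simp
  also have "(norm (d - a))\<^sup>2 = (norm d)\<^sup>2 - 2 * (a \<bullet> d) + (norm a)\<^sup>2"
    by (simp add: power2_norm_eq_inner inner_diff_left inner_diff_right inner_commute)
  finally show ?thesis by linarith
qed

text \<open>Expanding the square turns the projection into a one-sided quadratic estimate. Unlike the
  projection itself, this estimate can be added up, rescaled and localised.\<close>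

lemma prox_normal_cone_iff:
  "zs \<in> prox_normal_cone K z \<Omega> \<longleftrightarrow>
     z \<in> \<Omega> \<inter> K \<and>
     (\<exists>t>0. z + t *\<^sub>R zs \<in> K \<and> (\<forall>w\<in>\<Omega> \<inter> K. 2 * t * (zs \<bullet> (w - z)) \<le> (norm (w - z))\<^sup>2))"
proof -
  have "norm (z - (z + t *\<^sub>R zs)) \<le> norm (w - (z + t *\<^sub>R zs)) \<longleftrightarrow>
        2 * t * (zs \<bullet> (w - z)) \<le> (norm (w - z))\<^sup>2" for t w
    using norm_le_norm_diff_iff[of "t *\<^sub>R zs" "w - z"]
    by (simp add: algebra_simps)
  then show ?thesis
    unfolding prox_normal_cone_def proj_set_iff by auto
qed

text \<open>Points farther from \<open>z\<close> than \<open>\<rho>\<close> cannot beat \<open>z\<close> in the projection of \<open>z + t *\<^sub>R zs\<close> once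
  \<open>2 * t * norm zs \<le> \<rho>\<close>, and nearby points cannot once \<open>2 * t * \<sigma> \<le> 1\<close>. Convexity of \<open>K\<close> is
  what allows \<open>t\<close> to be decreased without leaving \<open>K\<close>.\<close>

lemma prox_normal_coneI_local:
  assumes K: "convex K" and z: "z \<in> \<Omega> \<inter> K"
    and t0: "t0 > 0" "z + t0 *\<^sub>R zs \<in> K" and \<rho>: "\<rho> > 0"
    and local_est: "\<And>w. w \<in> \<Omega> \<inter> K \<Longrightarrow> norm (w - z) \<le> \<rho> \<Longrightarrow> zs \<bullet> (w - z) \<le> \<sigma> * (norm (w - z))\<^sup>2"
  shows "zs \<in> prox_normal_cone K z \<Omega>"
proof -
  define m where "m = min t0 (min (1 / (2 * (\<bar>\<sigma>\<bar> + 1))) (\<rho> / (2 * (norm zs + 1))))"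
  have m: "m > 0" "m \<le> t0" "m \<le> 1 / (2 * (\<bar>\<sigma>\<bar> + 1))" "m \<le> \<rho> / (2 * (norm zs + 1))"
    using t0 \<rho> by (auto simp: m_def add_nonneg_pos)
  have m\<sigma>: "2 * m * \<sigma> \<le> 1"
  proof -
    have "2 * m * \<sigma> \<le> 2 * m * (\<bar>\<sigma>\<bar> + 1)" using m(1) by simp
    also have "\<dots> \<le> 1" using m(3) by (simp add: field_simps)
    finally show ?thesis .
  qed
  have m\<rho>: "2 * m * norm zs \<le> \<rho>"
  proof -
    have "2 * m * norm zs \<le> 2 * m * (norm zs + 1)" using m(1) by simp
    also have "\<dots> \<le> \<rho>"
      using m(4) pos_le_divide_eq[of "2 * (norm zs + 1)" m \<rho>]
      by (simp add: add_nonneg_pos mult_ac)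
    finally show ?thesis .
  qed
  have "z + m *\<^sub>R zs = (1 - m / t0) *\<^sub>R z + (m / t0) *\<^sub>R (z + t0 *\<^sub>R zs)"
    using t0(1) by (simp add: algebra_simps)
  also have "\<dots> \<in> K"
    by (rule convexD[OF K]) (use z t0 m in auto)
  finally have "z + m *\<^sub>R zs \<in> K" .
  moreover have "2 * m * (zs \<bullet> (w - z)) \<le> (norm (w - z))\<^sup>2" if w: "w \<in> \<Omega> \<inter> K" for w
  proof (cases "norm (w - z) \<le> \<rho>")
    case True
    have "2 * m * (zs \<bullet> (w - z)) \<le> 2 * m * (\<sigma> * (norm (w - z))\<^sup>2)"
      using local_est[OF w True] m(1) by simp
    also have "\<dots> = (2 * m * \<sigma>) * (norm (w - z))\<^sup>2" by simp
    also have "\<dots> \<le> 1 * (norm (w - z))\<^sup>2"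
      by (rule mult_right_mono[OF m\<sigma>]) simp
    finally show ?thesis by simp
  next
    case False
    have "2 * m * (zs \<bullet> (w - z)) \<le> 2 * m * (norm zs * norm (w - z))"
      using norm_cauchy_schwarz[of zs "w - z"] m(1) by simp
    also have "\<dots> = (2 * m * norm zs) * norm (w - z)" by simp
    also have "\<dots> \<le> norm (w - z) * norm (w - z)"
      by (rule mult_right_mono) (use m\<rho> False in auto)
    finally show ?thesis by (simp add: power2_eq_square)
  qed
  ultimately show ?thesis
    using z m(1) unfolding prox_normal_cone_iff by blast
qed

lemma prox_normal_cone_scaleR:
  assumes "zs \<in> prox_normal_cone K z \<Omega>" and c: "c > 0"
  shows "c *\<^sub>R zs \<in> prox_normal_cone K z \<Omega>"
proof -
  from assms(1) obtain t where t: "t > 0" "z + t *\<^sub>R zs \<in> K" "z \<in> \<Omega> \<inter> K"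
      "\<And>w. w \<in> \<Omega> \<inter> K \<Longrightarrow> 2 * t * (zs \<bullet> (w - z)) \<le> (norm (w - z))\<^sup>2"
    unfolding prox_normal_cone_iff by blast
  show ?thesis
    unfolding prox_normal_cone_iff
    using t c by (intro conjI exI[of _ "t / c"]) (auto simp: mult.assoc)
qed

lemma lim_normal_cone_scaleR:
  assumes "zs \<in> lim_normal_cone K z \<Omega>" and "c > 0"
  shows "c *\<^sub>R zs \<in> lim_normal_cone K z \<Omega>"
proof -
  from assms(1) obtain w ws where
    w: "\<And>k. w k \<in> \<Omega> \<inter> K" "\<And>k. ws k \<in> prox_normal_cone K (w k) \<Omega>" "w \<longlonglongrightarrow> z" "ws \<longlonglongrightarrow> zs"
    unfolding lim_normal_cone_def by blast
  have "(\<lambda>k. c *\<^sub>R ws k) \<longlonglongrightarrow> c *\<^sub>R zs"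
    by (intro tendsto_intros w)
  then show ?thesis
    unfolding lim_normal_cone_def mem_Collect_eq
    using w(1,3) prox_normal_cone_scaleR[OF w(2) assms(2)]
    by (intro exI[of _ w] exI[of _ "\<lambda>k. c *\<^sub>R ws k"]) simp
qed

lemma lim_coderivative_scaleR:
  assumes "xs \<in> lim_coderivative C F xb yb ys" and "c > 0"
  shows "c *\<^sub>R xs \<in> lim_coderivative C F xb yb (c *\<^sub>R ys)"
  using lim_normal_cone_scaleR[of "(xs, - ys)", OF _ assms(2)] assms(1)
  by (simp add: lim_coderivative_def)

lemma zero_in_lim_coderivative_zero:
  assumes "xb \<in> C" "yb \<in> F xb"
  shows "0 \<in> lim_coderivative C F xb yb 0"
proof -
  have z: "(xb, yb) \<in> gph (svrestrict F C) \<inter> (C \<times> UNIV)"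
    using assms by (simp add: gph_def svrestrict_def)
  then have "0 \<in> prox_normal_cone (C \<times> UNIV) (xb, yb) (gph (svrestrict F C))"
    unfolding prox_normal_cone_iff by (intro conjI exI[of _ 1]) auto
  with z show ?thesis
    unfolding lim_coderivative_def lim_normal_cone_def mem_Collect_eq
    by (intro exI[of _ "\<lambda>_. (xb, yb)"] exI[of _ "\<lambda>_. 0"]) (auto simp: zero_prod_def)
qed

lemma sv_norm_lim_coderivative_nonneg:
  assumes "xb \<in> C" "yb \<in> F xb"
  shows "0 \<le> sv_norm (lim_coderivative C F xb yb)"
  unfolding sv_norm_def
  by (rule Sup_upper2[of "ereal (norm (0::'a))"])
     (use zero_in_lim_coderivative_zero[where F = F, OF assms] in force)+

section \<open>The Aubin property bounds the coderivative\<close>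

lemma fattening_iff:
  fixes p :: "'a::real_normed_vector"
  assumes "0 \<le> r"
  shows "p \<in> {y + r *\<^sub>R b | y b. y \<in> S \<and> b \<in> cball 0 1} \<longleftrightarrow> (\<exists>y\<in>S. norm (p - y) \<le> r)"
proof
  assume "p \<in> {y + r *\<^sub>R b | y b. y \<in> S \<and> b \<in> cball 0 1}"
  then obtain y b where "p = y + r *\<^sub>R b" "y \<in> S" "norm b \<le> 1" by auto
  then show "\<exists>y\<in>S. norm (p - y) \<le> r"
    using assms by (intro bexI[of _ y]) (auto simp: mult_left_le)
next
  assume "\<exists>y\<in>S. norm (p - y) \<le> r"
  then obtain y where y: "y \<in> S" "norm (p - y) \<le> r" by blast
  show "p \<in> {y + r *\<^sub>R b | y b. y \<in> S \<and> b \<in> cball 0 1}"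
  proof (cases "r = 0")
    case True
    then show ?thesis using y by (auto intro!: exI[of _ 0])
  next
    case False
    have "p = y + r *\<^sub>R ((1 / r) *\<^sub>R (p - y))" using False by simp
    moreover have "(1 / r) *\<^sub>R (p - y) \<in> cball 0 1"
      using y False assms by (simp add: divide_le_eq del: scaleR_diff_right)
    ultimately show ?thesis using y(1) by blast
  qed
qed

text \<open>A proximal normal \<open>(xs, - ys)\<close> at \<open>(u, v)\<close> allows steps from \<open>u\<close> in the direction \<open>xs\<close> inside \<open>C\<close>,
  and along these steps the Aubin property supplies graph points \<open>(u + s *\<^sub>R xs, y)\<close> with
  \<open>norm (y - v) \<le> \<kappa> * s * norm xs\<close>. The quadratic estimate at these points is a bound of first
  order in \<open>s\<close> up to terms of order \<open>s\<^sup>2\<close>; as \<open>s\<close> tends to zero it becomes the claim.\<close>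

lemma aubin_constant_prox_normal_bound:
  fixes F :: "'a::euclidean_space \<Rightarrow> 'b::euclidean_space set"
  assumes C: "convex C" and \<kappa>: "0 \<le> \<kappa>"
    and U: "open U" "u \<in> U"
    and aubin: "\<And>x. x \<in> C \<inter> U \<Longrightarrow> \<exists>y\<in>F x. norm (v - y) \<le> \<kappa> * norm (u - x)"
    and N: "(xs, - ys) \<in> prox_normal_cone (C \<times> UNIV) (u, v) (gph (svrestrict F C))"
  shows "norm xs \<le> \<kappa> * norm ys"
proof -
  let ?G = "gph (svrestrict F C)"
  from N obtain t where uv: "(u, v) \<in> ?G \<inter> (C \<times> UNIV)" and t: "t > 0" "u + t *\<^sub>R xs \<in> C"
    and est: "\<And>w. w \<in> ?G \<inter> (C \<times> UNIV) \<Longrightarrow>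
        2 * t * ((xs, - ys) \<bullet> (w - (u, v))) \<le> (norm (w - (u, v)))\<^sup>2"
    unfolding prox_normal_cone_iff by auto
  have uC: "u \<in> C" using uv by auto
  have inC: "u + s *\<^sub>R xs \<in> C" if "0 \<le> s" "s \<le> t" for s
  proof -
    have "u + s *\<^sub>R xs = (1 - s / t) *\<^sub>R u + (s / t) *\<^sub>R (u + t *\<^sub>R xs)"
      using t(1) by (simp add: algebra_simps)
    also have "\<dots> \<in> C"
      by (rule convexD[OF C uC t(2)]) (use t(1) that in auto)
    finally show ?thesis .
  qed
  have "((\<lambda>s. u + s *\<^sub>R xs) \<longlongrightarrow> u + 0 *\<^sub>R xs) (at_right (0::real))"
    by (intro tendsto_intros)
  then have evU: "\<forall>\<^sub>F s in at_right (0::real). u + s *\<^sub>R xs \<in> U"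
    using U by (intro topological_tendstoD) auto
  have evt: "\<forall>\<^sub>F s in at_right (0::real). s < t \<and> 0 < s"
    using t(1) eventually_at_right_field by blast
  let ?A = "2 * t * ((norm xs)\<^sup>2 - \<kappa> * norm xs * norm ys)"
  let ?B = "(1 + \<kappa>\<^sup>2) * (norm xs)\<^sup>2"
  have "\<forall>\<^sub>F s in at_right (0::real). ?A \<le> s * ?B"
    using evU evt
  proof eventually_elim
    case (elim s)
    define x where "x = u + s *\<^sub>R xs"
    have x: "x \<in> C \<inter> U" using elim inC by (auto simp: x_def)
    from aubin[OF x] obtain y where y: "y \<in> F x" "norm (v - y) \<le> \<kappa> * norm (u - x)" by blast
    have ny: "norm (y - v) \<le> s * (\<kappa> * norm xs)"
      using y(2) elim by (simp add: x_def norm_minus_commute mult_ac)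
    have "(x, y) \<in> ?G \<inter> (C \<times> UNIV)" using x y by (auto simp: gph_def svrestrict_def)
    from est[OF this]
    have "2 * t * (s * (norm xs)\<^sup>2 - ys \<bullet> (y - v)) \<le> s\<^sup>2 * (norm xs)\<^sup>2 + (norm (y - v))\<^sup>2"
      by (simp add: x_def norm_Pair power_mult_distrib power2_norm_eq_inner[of xs])
    moreover have "ys \<bullet> (y - v) \<le> s * (\<kappa> * norm xs) * norm ys"
    proof -
      have "ys \<bullet> (y - v) \<le> norm ys * norm (y - v)" by (rule norm_cauchy_schwarz)
      also have "\<dots> \<le> norm ys * (s * (\<kappa> * norm xs))" by (rule mult_left_mono[OF ny]) simp
      finally show ?thesis by (simp add: mult_ac)
    qed
    then have "2 * t * (s * (norm xs)\<^sup>2 - s * (\<kappa> * norm xs) * norm ys)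
        \<le> 2 * t * (s * (norm xs)\<^sup>2 - ys \<bullet> (y - v))"
      using t(1) by simp
    moreover have "(norm (y - v))\<^sup>2 \<le> (s * (\<kappa> * norm xs))\<^sup>2"
      by (rule power_mono[OF ny]) simp
    ultimately have "2 * t * (s * (norm xs)\<^sup>2 - s * (\<kappa> * norm xs) * norm ys)
        \<le> s\<^sup>2 * (norm xs)\<^sup>2 + (s * (\<kappa> * norm xs))\<^sup>2" by linarith
    then have "s * ?A \<le> s * (s * ?B)"
      by (simp add: algebra_simps power2_eq_square)
    then show ?case using elim by simp
  qed
  moreover have "((\<lambda>s. s * ?B) \<longlongrightarrow> 0 * ?B) (at_right (0::real))"
    by (intro tendsto_intros)
  ultimately have "?A \<le> 0 * ?B"
    by (intro tendsto_le[OF _ _ tendsto_const]) auto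
  then have "norm xs * norm xs \<le> (\<kappa> * norm ys) * norm xs"
    using t(1) by (simp add: mult_le_0_iff power2_eq_square mult_ac)
  then show ?thesis
    using \<kappa> by (cases "xs = 0") auto
qed

lemma aubin_constant_coderivative_bound:
  fixes F :: "'a::euclidean_space \<Rightarrow> 'b::euclidean_space set"
  assumes C: "convex C" and ac: "aubin_constant C F xb yb \<kappa>"
    and xs: "xs \<in> lim_coderivative C F xb yb ys"
  shows "norm xs \<le> \<kappa> * norm ys"
proof -
  let ?G = "gph (svrestrict F C)"
  from ac obtain U V where \<kappa>: "0 \<le> \<kappa>" and UV: "xb \<in> interior U" "yb \<in> interior V"
    and incl: "\<forall>x \<in> C \<inter> U. \<forall>u \<in> C \<inter> U.
       F u \<inter> V \<subseteq> {y + (\<kappa> * norm (u - x)) *\<^sub>R b | y b. y \<in> F x \<and> b \<in> cball 0 1}"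
    unfolding aubin_constant_def by blast
  from xs obtain w ws where
    w: "\<And>k. w k \<in> ?G \<inter> (C \<times> UNIV)" "\<And>k. ws k \<in> prox_normal_cone (C \<times> UNIV) (w k) ?G"
      "w \<longlonglongrightarrow> (xb, yb)" "ws \<longlonglongrightarrow> (xs, - ys)"
    unfolding lim_coderivative_def lim_normal_cone_def by blast
  have "\<forall>\<^sub>F k in sequentially. w k \<in> interior U \<times> interior V"
    using w(3) UV by (intro topological_tendstoD open_Times) auto
  then have ev: "\<forall>\<^sub>F k in sequentially. norm (fst (ws k)) \<le> \<kappa> * norm (snd (ws k))"
  proof eventually_elim
    case (elim k)
    obtain u v where wk: "w k = (u, v)" by force
    obtain p q where wsk: "ws k = (p, - q)" by (metis minus_minus surj_pair)
    have uv: "u \<in> C" "v \<in> F u" "u \<in> interior U" "v \<in> interior V"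
      using w(1)[of k] elim by (auto simp: wk gph_def svrestrict_def split: if_splits)
    have "norm p \<le> \<kappa> * norm q"
    proof (rule aubin_constant_prox_normal_bound[OF C \<kappa> open_interior uv(3)])
      show "(p, - q) \<in> prox_normal_cone (C \<times> UNIV) (u, v) ?G"
        using w(2)[of k] by (simp add: wk wsk)
      fix x assume x: "x \<in> C \<inter> interior U"
      have "F u \<inter> V \<subseteq> {y + (\<kappa> * norm (u - x)) *\<^sub>R b | y b. y \<in> F x \<and> b \<in> cball 0 1}"
        using incl x uv interior_subset by blast
      moreover have "v \<in> F u \<inter> V" using uv interior_subset by blast
      ultimately show "\<exists>y\<in>F x. norm (v - y) \<le> \<kappa> * norm (u - x)"
        using \<kappa> by (subst fattening_iff[symmetric]) auto
    qed
    then show ?case by (simp add: wsk)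
  qed
  have "(\<lambda>k. norm (fst (ws k))) \<longlonglongrightarrow> norm (fst (xs, - ys))"
    "(\<lambda>k. \<kappa> * norm (snd (ws k))) \<longlonglongrightarrow> \<kappa> * norm (snd (xs, - ys))"
    by (intro tendsto_intros w(4))+
  then have "norm (fst (xs, - ys)) \<le> \<kappa> * norm (snd (xs, - ys))"
    using ev by (intro tendsto_le[of sequentially]) auto
  then show ?thesis by simp
qed

section \<open>Minimisation yields Aubin constants\<close>

text \<open>The tangent to the square root at \<open>a\<^sup>2\<close> lies above it. This is all the smoothness of the
  Euclidean norm that the minimisation argument needs.\<close>

lemma sqrt_norm_upper_quadratic:
  fixes p d :: "'a::real_inner"
  assumes a: "a = sqrt ((norm p)\<^sup>2 + \<delta>\<^sup>2)" "a > 0"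
  shows "sqrt ((norm (p + d))\<^sup>2 + \<delta>\<^sup>2) \<le> a + ((1 / a) *\<^sub>R p) \<bullet> d + (norm d)\<^sup>2 / (2 * a)"
proof -
  define b where "b = sqrt ((norm (p + d))\<^sup>2 + \<delta>\<^sup>2)"
  have a2: "a\<^sup>2 = (norm p)\<^sup>2 + \<delta>\<^sup>2" using a by simp
  have "b\<^sup>2 = (norm (p + d))\<^sup>2 + \<delta>\<^sup>2" by (simp add: b_def)
  also have "\<dots> = a\<^sup>2 + 2 * (p \<bullet> d) + (norm d)\<^sup>2"
    by (simp add: a2 power2_norm_eq_inner inner_add_left inner_add_right inner_commute)
  finally have b2: "b\<^sup>2 = a\<^sup>2 + 2 * (p \<bullet> d) + (norm d)\<^sup>2" .
  have "0 \<le> (b - a)\<^sup>2" by simp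
  then have "2 * a * b \<le> b\<^sup>2 + a\<^sup>2" by (simp add: power2_diff mult_ac)
  moreover have "2 * a * (a + (p \<bullet> d) / a + (norm d)\<^sup>2 / (2 * a)) =
      2 * a\<^sup>2 + 2 * (p \<bullet> d) + (norm d)\<^sup>2"
    using a(2) by (simp add: distrib_left power2_eq_square)
  ultimately have "2 * a * b \<le> 2 * a * (a + (p \<bullet> d) / a + (norm d)\<^sup>2 / (2 * a))"
    using b2 by linarith
  then have "b \<le> a + (p \<bullet> d) / a + (norm d)\<^sup>2 / (2 * a)"
    using a(2) by simp
  then show ?thesis by (simp add: b_def)
qed

text \<open>A minimiser \<open>(u, v)\<close> of \<open>norm (u - x) + \<beta> * sqrt ((norm (v - y))\<^sup>2 + \<delta>\<^sup>2)\<close> on the graph has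
  the negative gradient as a proximal normal if \<open>u \<noteq> x\<close>. Its first component points from \<open>u\<close> to
  the point \<open>x\<close> of \<open>C\<close>, so the normal respects \<open>C\<close>. The smoothing parameter \<open>\<delta>\<close> keeps the second
  summand differentiable where \<open>v = y\<close>.\<close>

lemma minimiser_prox_normal:
  fixes F :: "'a::euclidean_space \<Rightarrow> 'b::euclidean_space set"
  assumes C: "convex C" "x \<in> C" and uv: "(u, v) \<in> gph (svrestrict F C)" and ux: "u \<noteq> x"
    and \<beta>: "0 \<le> \<beta>" and \<delta>: "\<delta> > 0" and \<rho>: "\<rho> > 0"
    and min: "\<And>u' v'. (u', v') \<in> gph (svrestrict F C) \<Longrightarrow> norm ((u', v') - (u, v)) \<le> \<rho> \<Longrightarrow>
       norm (u - x) + \<beta> * sqrt ((norm (v - y))\<^sup>2 + \<delta>\<^sup>2)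
         \<le> norm (u' - x) + \<beta> * sqrt ((norm (v' - y))\<^sup>2 + \<delta>\<^sup>2)"
  obtains xs ys where "norm xs = 1" "norm ys \<le> \<beta>"
    "(xs, - ys) \<in> prox_normal_cone (C \<times> UNIV) (u, v) (gph (svrestrict F C))"
proof -
  let ?G = "gph (svrestrict F C)"
  define a where "a = norm (u - x)"
  define b where "b = sqrt ((norm (v - y))\<^sup>2 + \<delta>\<^sup>2)"
  define xs where "xs = (1 / a) *\<^sub>R (x - u)"
  define ys where "ys = (\<beta> / b) *\<^sub>R (v - y)"
  define \<sigma> where "\<sigma> = 1 / (2 * a) + \<beta> / (2 * b)"
  have a: "a > 0" using ux by (simp add: a_def)
  have b: "b > 0" using \<delta> by (simp add: b_def add_nonneg_pos)
  have uC: "u \<in> C" using uv by (auto simp: gph_def svrestrict_def split: if_splits)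
  have nb: "norm (v - y) \<le> b" by (simp add: b_def real_le_rsqrt)
  have "norm xs = 1" using a by (simp add: xs_def a_def norm_minus_commute)
  moreover have "norm ys \<le> \<beta>"
  proof -
    have "norm ys = \<beta> * norm (v - y) / b" using \<beta> b by (simp add: ys_def del: scaleR_diff_right)
    also have "\<dots> \<le> \<beta>" using mult_left_mono[OF nb \<beta>] b by (simp add: divide_le_eq)
    finally show ?thesis .
  qed
  moreover have "(xs, - ys) \<in> prox_normal_cone (C \<times> UNIV) (u, v) ?G"
  proof (rule prox_normal_coneI_local[where ?t0.0 = a and \<rho> = \<rho> and \<sigma> = \<sigma>])
    show "convex (C \<times> (UNIV :: 'b set))" by (intro convex_Times C convex_UNIV)
    show "(u, v) \<in> ?G \<inter> (C \<times> UNIV)" using uv uC by auto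
    show "(u, v) + a *\<^sub>R (xs, - ys) \<in> C \<times> UNIV" using a C by (simp add: xs_def)
    fix w assume w: "w \<in> ?G \<inter> (C \<times> UNIV)" "norm (w - (u, v)) \<le> \<rho>"
    obtain u' v' where ww: "w = (u', v')" by force
    have "norm (u' - x) \<le> a + ((1 / a) *\<^sub>R (u - x)) \<bullet> (u' - u) + (norm (u' - u))\<^sup>2 / (2 * a)"
      using sqrt_norm_upper_quadratic[of a "u - x" 0 "u' - u"] a by (simp add: a_def)
    moreover have "\<beta> * sqrt ((norm (v' - y))\<^sup>2 + \<delta>\<^sup>2)
        \<le> \<beta> * (b + ((1 / b) *\<^sub>R (v - y)) \<bullet> (v' - v) + (norm (v' - v))\<^sup>2 / (2 * b))"
      using sqrt_norm_upper_quadratic[OF b_def b, of "v' - v"] \<beta>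
      by (intro mult_left_mono) auto
    ultimately have "a + \<beta> * b \<le> a + ((1 / a) *\<^sub>R (u - x)) \<bullet> (u' - u) + (norm (u' - u))\<^sup>2 / (2 * a)
        + \<beta> * (b + ((1 / b) *\<^sub>R (v - y)) \<bullet> (v' - v) + (norm (v' - v))\<^sup>2 / (2 * b))"
      using min[of u' v'] w unfolding ww a_def b_def by fastforce
    moreover have "(xs, - ys) \<bullet> (w - (u, v)) =
        - (((1 / a) *\<^sub>R (u - x)) \<bullet> (u' - u)) - \<beta> * (((1 / b) *\<^sub>R (v - y)) \<bullet> (v' - v))"
      unfolding ww xs_def ys_def minus_diff_eq[of u x, symmetric] scaleR_minus_right
      by simp
    ultimately have "(xs, - ys) \<bullet> (w - (u, v))
        \<le> (norm (u' - u))\<^sup>2 / (2 * a) + \<beta> * ((norm (v' - v))\<^sup>2 / (2 * b))"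
      by (simp only: distrib_left)
    also have "\<dots> = (1 / (2 * a)) * (norm (u' - u))\<^sup>2 + (\<beta> / (2 * b)) * (norm (v' - v))\<^sup>2"
      by simp
    also have "\<dots> \<le> \<sigma> * (norm (u' - u))\<^sup>2 + \<sigma> * (norm (v' - v))\<^sup>2"
      using a b \<beta> by (intro add_mono mult_right_mono) (auto simp: \<sigma>_def)
    also have "\<dots> = \<sigma> * (norm (w - (u, v)))\<^sup>2"
      by (simp add: ww norm_Pair distrib_left)
    finally show "(xs, - ys) \<bullet> (w - (u, v)) \<le> \<sigma> * (norm (w - (u, v)))\<^sup>2" .
  qed (use a \<rho> in auto)
  ultimately show ?thesis by (rule that)
qed

text \<open>To pass from \<open>y \<in> F u\<close> to a point of \<open>F x\<close>, minimise
  \<open>norm (u' - x) + \<beta> * sqrt ((norm (v' - y))\<^sup>2 + \<delta>\<^sup>2)\<close> over graph points \<open>(u', v')\<close> near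
  \<open>(xb, yb)\<close>. By the preceding lemma the hypothesis leaves no choice but \<open>u' = x\<close>, and
  comparison with the value at \<open>(u, y)\<close> gives \<open>\<beta> * norm (v' - y) \<le> norm (u - x) + \<beta> * \<delta>\<close>. The gap
  between \<open>1 / \<beta>\<close> and \<open>\<kappa>\<close> absorbs \<open>\<delta>\<close>.\<close>

lemma aubin_constant_if_no_steep_prox_normal:
  fixes F :: "'a::euclidean_space \<Rightarrow> 'b::euclidean_space set"
  assumes C: "closed C" "convex C"
    and lc: "locally_closed_around (gph F) (xb, yb)"
    and \<beta>: "\<beta> > 0" and \<kappa>: "1 / \<beta> < \<kappa>" and r: "r > 0"
    and flat: "\<And>w xs ys. w \<in> ball (xb, yb) r \<Longrightarrow>
       (xs, - ys) \<in> prox_normal_cone (C \<times> UNIV) w (gph (svrestrict F C)) \<Longrightarrow>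
       norm xs = 1 \<Longrightarrow> norm ys \<le> \<beta> \<Longrightarrow> False"
  shows "aubin_constant C F xb yb \<kappa>"
proof -
  let ?G = "gph (svrestrict F C)"
  have \<kappa>0: "\<kappa> > 0" using \<beta> \<kappa> by (smt (verit) divide_pos_pos)
  from lc obtain \<epsilon> where \<epsilon>: "\<epsilon> > 0" "\<And>s. 0 < s \<Longrightarrow> s \<le> \<epsilon> \<Longrightarrow> closed (gph F \<inter> cball (xb, yb) s)"
    unfolding locally_closed_around_def by blast
  define R where "R = min \<epsilon> r"
  have R: "R > 0" "R \<le> \<epsilon>" "R \<le> r" using \<epsilon> r by (auto simp: R_def)
  have "?G \<inter> cball (xb, yb) R = (gph F \<inter> cball (xb, yb) R) \<inter> (C \<times> UNIV)"
    by (auto simp: gph_def svrestrict_def split: if_splits)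
  moreover have "closed \<dots>"
    using closed_Int[OF \<epsilon>(2)[OF R(1,2)] closed_Times[OF C(1) closed_UNIV]] .
  ultimately have cpt: "compact (?G \<inter> cball (xb, yb) R)"
    by (metis compact_Int_closed compact_cball inf.right_idem inf_commute)
  have in_cball: "w \<in> cball (xb, yb) s \<longleftrightarrow> norm (w - (xb, yb)) \<le> s" for w s
    by (simp add: dist_norm norm_minus_commute)
  define M where "M = 5 + 2 * \<beta> + 2 / \<beta>"
  have M: "M > 0" using \<beta> by (simp add: M_def add_pos_pos)
  define \<eta> where "\<eta> = R / (2 * M)"
  have \<eta>: "\<eta> > 0" "M * \<eta> < R" using R M by (auto simp: \<eta>_def)
  have key: "\<exists>y'\<in>F x. norm (y - y') \<le> \<kappa> * norm (u - x)"
    if x: "x \<in> C" "norm (x - xb) < \<eta>" and u: "u \<in> C" "norm (u - xb) < \<eta>"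
      and y: "y \<in> F u" "norm (y - yb) < \<eta>" for x u y
  proof (cases "u = x")
    case True
    then show ?thesis using y by (intro bexI[of _ y]) auto
  next
    case False
    define l where "l = norm (u - x)"
    have l: "l > 0" using False by (simp add: l_def)
    have "l \<le> norm (u - xb) + norm (x - xb)"
      using norm_triangle_ineq4[of "u - xb" "x - xb"] by (simp add: l_def)
    then have l2: "l < 2 * \<eta>" using x u by simp
    define \<delta> where "\<delta> = min \<eta> ((\<kappa> - 1 / \<beta>) * l)"
    have \<delta>: "\<delta> > 0" "\<delta> \<le> \<eta>" "\<delta> \<le> (\<kappa> - 1 / \<beta>) * l"
      using \<eta> \<kappa> l by (auto simp: \<delta>_def)
    define f where "f = (\<lambda>z. norm (fst z - x) + \<beta> * sqrt ((norm (snd z - y))\<^sup>2 + \<delta>\<^sup>2))"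
    have "norm ((u, y) - (xb, yb)) \<le> norm (u - xb) + norm (y - yb)"
      using norm_Pair_le[of "u - xb" "y - yb"] by simp
    also have "\<dots> \<le> M * \<eta>"
    proof -
      have "2 \<le> M" using \<beta> by (simp add: M_def)
      then have "2 * \<eta> \<le> M * \<eta>" using \<eta> by simp
      then show ?thesis using u y by linarith
    qed
    finally have uy: "(u, y) \<in> ?G \<inter> cball (xb, yb) R"
      using u y \<eta> by (simp add: in_cball gph_def svrestrict_def del: mem_cball)
    have "continuous_on (?G \<inter> cball (xb, yb) R) f"
      unfolding f_def by (intro continuous_intros)
    then obtain z where z: "z \<in> ?G \<inter> cball (xb, yb) R"
      and zmin: "\<And>w. w \<in> ?G \<inter> cball (xb, yb) R \<Longrightarrow> f z \<le> f w"
      using continuous_attains_inf[OF cpt] uy by blast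
    obtain p q where zpq: "z = (p, q)" by force
    have fz: "norm (p - x) + \<beta> * sqrt ((norm (q - y))\<^sup>2 + \<delta>\<^sup>2) \<le> l + \<beta> * \<delta>"
      using zmin[OF uy] \<delta>(1) by (simp add: f_def zpq l_def)
    have q: "\<beta> * norm (q - y) \<le> \<beta> * sqrt ((norm (q - y))\<^sup>2 + \<delta>\<^sup>2)"
      using \<beta> by (simp add: real_le_rsqrt)
    have px: "norm (p - x) \<le> l + \<beta> * \<delta>" using fz q \<beta> by (smt (verit) mult_nonneg_nonneg norm_ge_zero)
    have qy: "norm (q - y) \<le> l / \<beta> + \<delta>"
    proof -
      have "\<beta> * norm (q - y) \<le> l + \<beta> * \<delta>" using fz q by (smt (verit) norm_ge_zero)
      then show ?thesis using \<beta> by (simp add: field_simps)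
    qed
    \<comment> \<open>The constant \<open>M\<close> is chosen so that the minimiser lies strictly inside the ball on which the
      minimum is taken.\<close>
    have "norm (z - (xb, yb)) \<le> norm (p - xb) + norm (q - yb)"
      using norm_Pair_le[of "p - xb" "q - yb"] by (simp add: zpq)
    also have "\<dots> \<le> (norm (p - x) + norm (x - xb)) + (norm (q - y) + norm (y - yb))"
      using norm_triangle_ineq[of "p - x" "x - xb"] norm_triangle_ineq[of "q - y" "y - yb"] by simp
    also have "\<dots> < M * \<eta>"
    proof -
      have "l / \<beta> \<le> 2 * \<eta> / \<beta>" using l2 \<beta> by (simp add: divide_right_mono)
      moreover have "\<beta> * \<delta> \<le> \<beta> * \<eta>" using \<delta>(2) \<beta> by simp
      moreover have "M * \<eta> = 5 * \<eta> + 2 * (\<beta> * \<eta>) + 2 * \<eta> / \<beta>" by (simp add: M_def algebra_simps)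
      moreover have "\<beta> * \<eta> > 0" using \<beta> \<eta> by simp
      ultimately show ?thesis using px qy x(2) y(2) l2 \<delta>(2) by linarith
    qed
    finally have zin: "norm (z - (xb, yb)) < R" using \<eta>(2) by simp
    define \<rho> where "\<rho> = R - norm (z - (xb, yb))"
    have \<rho>: "\<rho> > 0" using zin by (simp add: \<rho>_def)
    have px_eq: "p = x"
    proof (rule ccontr)
      assume "p \<noteq> x"
      have pq: "(p, q) \<in> ?G" using z zpq by auto
      have min: "norm (p - x) + \<beta> * sqrt ((norm (q - y))\<^sup>2 + \<delta>\<^sup>2)
         \<le> norm (u' - x) + \<beta> * sqrt ((norm (v' - y))\<^sup>2 + \<delta>\<^sup>2)"
        if "(u', v') \<in> ?G" "norm ((u', v') - (p, q)) \<le> \<rho>" for u' v'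
      proof -
        have "norm ((u', v') - (xb, yb)) \<le> \<rho> + norm (z - (xb, yb))"
          by (rule norm_diff_triangle_le[OF that(2)]) (simp add: zpq)
        then have "(u', v') \<in> ?G \<inter> cball (xb, yb) R"
          using that(1) by (simp add: \<rho>_def in_cball del: mem_cball)
        from zmin[OF this] show ?thesis by (simp add: f_def zpq)
      qed
      obtain xs ys where "norm xs = 1" "norm ys \<le> \<beta>"
          "(xs, - ys) \<in> prox_normal_cone (C \<times> UNIV) (p, q) ?G"
        by (rule minimiser_prox_normal[OF C(2) x(1) pq \<open>p \<noteq> x\<close> _ \<delta>(1) \<rho> min])
           (use \<beta> in auto)
      moreover have "(p, q) \<in> ball (xb, yb) r"
        using zin R(3) unfolding zpq mem_ball dist_norm by (simp only: norm_minus_commute)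
      ultimately show False using flat by blast
    qed
    have "q \<in> F x" using z by (auto simp: zpq px_eq gph_def svrestrict_def split: if_splits)
    moreover have "norm (y - q) \<le> \<kappa> * norm (u - x)"
    proof -
      have "l / \<beta> + \<delta> \<le> \<kappa> * l" using \<delta>(3) by (simp add: algebra_simps)
      then show ?thesis using qy by (simp add: l_def norm_minus_commute)
    qed
    ultimately show ?thesis by blast
  qed
  have "F u \<inter> ball yb \<eta> \<subseteq> {y + (\<kappa> * norm (u - x)) *\<^sub>R b | y b. y \<in> F x \<and> b \<in> cball 0 1}"
    if "x \<in> C \<inter> ball xb \<eta>" "u \<in> C \<inter> ball xb \<eta>" for x u
  proof
    fix y assume "y \<in> F u \<inter> ball yb \<eta>"
    then show "y \<in> {y + (\<kappa> * norm (u - x)) *\<^sub>R b | y b. y \<in> F x \<and> b \<in> cball 0 1}"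
      using that key[of x u y] \<kappa>0
      by (subst fattening_iff) (auto simp: dist_norm norm_minus_commute)
  qed
  then show ?thesis
    unfolding aubin_constant_def using \<kappa>0 \<eta>(1)
    by (intro conjI exI[of _ "ball xb \<eta>"] exI[of _ "ball yb \<eta>"]) auto
qed

text \<open>As no \<open>\<kappa> k\<close> is an Aubin constant, steep proximal normals exist at graph points
  arbitrarily close to \<open>(xb, yb)\<close>; normalised to \<open>norm xs = 1\<close> they have a cluster point. A constant
  sequence \<open>\<beta>\<close> serves to compute the exact constant, and a sequence tending to zero to reach the
  coderivative at zero.\<close>

lemma steep_coderivative_if_not_aubin_constant:
  fixes F :: "'a::euclidean_space \<Rightarrow> 'b::euclidean_space set"
  assumes C: "closed C" "convex C"
    and lc: "locally_closed_around (gph F) (xb, yb)"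
    and not_aubin: "\<And>k. \<not> aubin_constant C F xb yb (\<kappa> k)"
    and \<beta>: "\<And>k. \<beta> k > 0" "\<And>k. 1 / \<beta> k < \<kappa> k" "\<beta> \<longlonglongrightarrow> \<beta>0"
  obtains xs ys where "xs \<in> lim_coderivative C F xb yb ys" "norm xs = 1" "norm ys \<le> \<beta>0"
proof -
  let ?G = "gph (svrestrict F C)" and ?K = "C \<times> (UNIV :: 'b set)"
  have "\<exists>w zs. w \<in> ball (xb, yb) (1 / Suc k) \<and> zs \<in> prox_normal_cone ?K w ?G \<and>
      norm (fst zs) = 1 \<and> norm (snd zs) \<le> \<beta> k" for k
  proof (rule ccontr)
    assume neg: "\<not> ?thesis"
    have "aubin_constant C F xb yb (\<kappa> k)"
      by (rule aubin_constant_if_no_steep_prox_normal[OF C lc \<beta>(1,2), of "1 / Suc k"])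
         (use neg in force)+
    then show False using not_aubin by blast
  qed
  then obtain w zs where
    w: "\<And>k. w k \<in> ball (xb, yb) (1 / Suc k)" and
    zs: "\<And>k. zs k \<in> prox_normal_cone ?K (w k) ?G" "\<And>k. norm (fst (zs k)) = 1"
      "\<And>k. norm (snd (zs k)) \<le> \<beta> k"
    by metis
  have wlim: "w \<longlonglongrightarrow> (xb, yb)"
  proof (rule metric_LIMSEQ_I)
    fix e :: real assume "e > 0"
    then obtain n where n: "1 / Suc n < e" using nat_approx_posE by blast
    have "dist (w k) (xb, yb) < e" if "k \<ge> n" for k
    proof -
      have "1 / real (Suc k) \<le> 1 / Suc n" using that by (intro divide_left_mono) auto
      then show ?thesis using w[of k] n by (simp add: dist_commute)
    qed
    then show "\<exists>no. \<forall>n\<ge>no. dist (w n) (xb, yb) < e" by blast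
  qed
  obtain B where B: "\<And>k. \<beta> k \<le> B"
    using convergent_imp_Bseq[OF convergentI[OF \<beta>(3)]] by (metis BseqE abs_le_D1 real_norm_def)
  have "zs k \<in> cball 0 1 \<times> cball 0 B" for k
    using zs(2,3)[of k] B[of k] by (simp add: mem_Times_iff)
  moreover have "compact (cball (0::'a) 1 \<times> cball (0::'b) B)" by (intro compact_Times compact_cball)
  ultimately obtain z \<phi> where \<phi>: "strict_mono (\<phi> :: nat \<Rightarrow> nat)" and z: "(zs \<circ> \<phi>) \<longlonglongrightarrow> z"
    unfolding compact_def by (metis (no_types, lifting))
  show ?thesis
  proof
    have "(w \<circ> \<phi>) \<longlonglongrightarrow> (xb, yb)" by (rule LIMSEQ_subseq_LIMSEQ[OF wlim \<phi>])
    moreover have "w k \<in> ?G \<inter> ?K" for k using zs(1) prox_normal_cone_iff by blast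
    ultimately show "fst z \<in> lim_coderivative C F xb yb (- snd z)"
      unfolding lim_coderivative_def lim_normal_cone_def mem_Collect_eq
      using z zs(1) by (intro exI[of _ "w \<circ> \<phi>"] exI[of _ "zs \<circ> \<phi>"]) auto
    have "(\<lambda>k. norm (fst ((zs \<circ> \<phi>) k))) \<longlonglongrightarrow> norm (fst z)" by (intro tendsto_intros z)
    then show "norm (fst z) = 1" by (simp add: zs(2) LIMSEQ_const_iff)
    have "(\<lambda>k. norm (snd ((zs \<circ> \<phi>) k))) \<longlonglongrightarrow> norm (snd z)" by (intro tendsto_intros z)
    moreover have "(\<beta> \<circ> \<phi>) \<longlonglongrightarrow> \<beta>0" by (rule LIMSEQ_subseq_LIMSEQ[OF \<beta>(3) \<phi>])
    ultimately have "norm (snd z) \<le> \<beta>0"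
      by (rule LIMSEQ_le) (use zs(3) in auto)
    then show "norm (- snd z) \<le> \<beta>0" by simp
  qed
qed

section \<open>The coderivative criterion\<close>

text \<open>The gap between the norm of the coderivative and \<open>\<kappa>\<close> leaves room for an intermediate slope
  \<open>\<alpha>\<close>. Were \<open>\<kappa>\<close> not an Aubin constant, rescaling a steep element of the coderivative by \<open>\<alpha>\<close>
  would push the norm of the coderivative up to \<open>\<alpha>\<close>.\<close>

lemma aubin_constant_if_sv_norm_less:
  fixes F :: "'a::euclidean_space \<Rightarrow> 'b::euclidean_space set"
  assumes C: "closed C" "convex C" and base: "xb \<in> C" "yb \<in> F xb"
    and lc: "locally_closed_around (gph F) (xb, yb)"
    and less: "sv_norm (lim_coderivative C F xb yb) < ereal \<kappa>"
  shows "aubin_constant C F xb yb \<kappa>"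
proof (rule ccontr)
  assume not_aubin: "\<not> aubin_constant C F xb yb \<kappa>"
  obtain \<alpha> where \<alpha>: "sv_norm (lim_coderivative C F xb yb) < ereal \<alpha>" "ereal \<alpha> < ereal \<kappa>"
    using ereal_dense2[OF less] by blast
  have \<alpha>0: "\<alpha> > 0"
    using sv_norm_lim_coderivative_nonneg[of xb C yb F] base \<alpha>(1) by (metis ereal_less(2) le_less_trans)
  obtain xs ys where xs: "xs \<in> lim_coderivative C F xb yb ys" "norm xs = 1" "norm ys \<le> 1 / \<alpha>"
    by (rule steep_coderivative_if_not_aubin_constant
          [OF C lc, of "\<lambda>_. \<kappa>" "\<lambda>_. 1 / \<alpha>" "1 / \<alpha>"])
       (use not_aubin \<alpha>0 \<alpha>(2) in auto)
  have "\<alpha> *\<^sub>R xs \<in> lim_coderivative C F xb yb (\<alpha> *\<^sub>R ys)"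
    by (rule lim_coderivative_scaleR[OF xs(1) \<alpha>0])
  moreover have "\<alpha> *\<^sub>R ys \<in> cball 0 1" "norm (\<alpha> *\<^sub>R xs) = \<alpha>"
    using xs \<alpha>0 by (auto simp: field_simps)
  ultimately have "ereal \<alpha> \<le> sv_norm (lim_coderivative C F xb yb)"
    unfolding sv_norm_def by (intro Sup_upper) force
  then show False using \<alpha>(1) by simp
qed

lemma aubin_exact_eq_sv_norm:
  fixes F :: "'a::euclidean_space \<Rightarrow> 'b::euclidean_space set"
  assumes C: "closed C" "convex C" and base: "xb \<in> C" "yb \<in> F xb"
    and lc: "locally_closed_around (gph F) (xb, yb)"
  shows "aubin_exact C F xb yb = sv_norm (lim_coderivative C F xb yb)"
proof (rule antisym)
  show "aubin_exact C F xb yb \<le> sv_norm (lim_coderivative C F xb yb)"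
  proof (rule ccontr)
    assume "\<not> ?thesis"
    then have "sv_norm (lim_coderivative C F xb yb) < aubin_exact C F xb yb" by simp
    from ereal_dense2[OF this] obtain \<kappa> where \<kappa>: "sv_norm (lim_coderivative C F xb yb) < ereal \<kappa>"
        "ereal \<kappa> < aubin_exact C F xb yb"
      by blast
    have "aubin_constant C F xb yb \<kappa>"
      by (rule aubin_constant_if_sv_norm_less[OF C base lc \<kappa>(1)])
    then have "aubin_exact C F xb yb \<le> ereal \<kappa>"
      unfolding aubin_exact_def by (intro Inf_lower) blast
    then show False using \<kappa>(2) by simp
  qed
  show "sv_norm (lim_coderivative C F xb yb) \<le> aubin_exact C F xb yb"
    unfolding sv_norm_def aubin_exact_def
  proof (intro Sup_least Inf_greatest; clarsimp)
    fix \<kappa> xs ys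
    assume ac: "aubin_constant C F xb yb \<kappa>" and ys: "norm ys \<le> 1"
      and xs: "xs \<in> lim_coderivative C F xb yb ys"
    have "norm xs \<le> \<kappa> * norm ys"
      by (rule aubin_constant_coderivative_bound[OF C(2) ac xs])
    also have "\<dots> \<le> \<kappa>" using ac ys by (simp add: aubin_constant_def mult_left_le)
    finally show "norm xs \<le> \<kappa>" .
  qed
qed

lemma aubin_property_iff_coderivative_zero:
  fixes F :: "'a::euclidean_space \<Rightarrow> 'b::euclidean_space set"
  assumes C: "closed C" "convex C" and base: "xb \<in> C" "yb \<in> F xb"
    and lc: "locally_closed_around (gph F) (xb, yb)"
  shows "aubin_property C F xb yb \<longleftrightarrow> lim_coderivative C F xb yb 0 = {0}"
proof
  assume "aubin_property C F xb yb"
  then obtain \<kappa> where \<kappa>: "aubin_constant C F xb yb \<kappa>" unfolding aubin_property_def by blast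
  have "xs = 0" if "xs \<in> lim_coderivative C F xb yb 0" for xs
    using aubin_constant_coderivative_bound[OF C(2) \<kappa> that] by simp
  moreover have "0 \<in> lim_coderivative C F xb yb 0"
    using base by (rule zero_in_lim_coderivative_zero)
  ultimately show "lim_coderivative C F xb yb 0 = {0}" by blast
next
  assume zero: "lim_coderivative C F xb yb 0 = {0}"
  show "aubin_property C F xb yb"
  proof (rule ccontr)
    assume "\<not> ?thesis"
    then have not_aubin: "\<not> aubin_constant C F xb yb \<kappa>" for \<kappa>
      using lc unfolding aubin_property_def by blast
    obtain xs ys where xs: "xs \<in> lim_coderivative C F xb yb ys" "norm xs = 1" "norm ys \<le> 0"
      by (rule steep_coderivative_if_not_aubin_constant
            [OF C lc, of "\<lambda>k. real (Suc (Suc k))" "\<lambda>k. 1 / real (Suc k)" 0])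
         (use not_aubin LIMSEQ_inverse_real_of_nat in \<open>auto simp: inverse_eq_divide\<close>)
    then show False using zero by auto
  qed
qed

text \<open>Since \<open>\<infinity> * 0 = 0\<close>, at \<open>\<kappa> = \<infinity>\<close> the bound says exactly that the coderivative at zero contains
  no nonzero vector.\<close>

lemma aubin_property_iff_coderivative_bound:
  fixes F :: "'a::euclidean_space \<Rightarrow> 'b::euclidean_space set"
  assumes C: "closed C" "convex C" and base: "xb \<in> C" "yb \<in> F xb"
    and lc: "locally_closed_around (gph F) (xb, yb)"
  shows "aubin_property C F xb yb \<longleftrightarrow>
    (\<forall>\<kappa>::ereal. aubin_exact C F xb yb \<le> \<kappa> \<longrightarrow>
       (\<forall>ys. \<forall>xs \<in> lim_coderivative C F xb yb ys. ereal (norm xs) \<le> \<kappa> * ereal (norm ys)))"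
proof (intro iffI allI impI ballI)
  fix \<kappa> :: ereal and ys xs
  assume ap: "aubin_property C F xb yb" and \<kappa>: "aubin_exact C F xb yb \<le> \<kappa>"
    and xs: "xs \<in> lim_coderivative C F xb yb ys"
  show "ereal (norm xs) \<le> \<kappa> * ereal (norm ys)"
  proof (cases "ys = 0")
    case True
    then show ?thesis
      using ap xs aubin_property_iff_coderivative_zero[where F = F, OF C base lc]
      by (simp flip: zero_ereal_def)
  next
    case False
    have "ereal (norm xs / norm ys) \<le> aubin_exact C F xb yb"
      unfolding aubin_exact_def
    proof (rule Inf_greatest, clarsimp)
      fix \<kappa>' assume "aubin_constant C F xb yb \<kappa>'"
      from aubin_constant_coderivative_bound[OF C(2) this xs]
      show "norm xs / norm ys \<le> \<kappa>'" using False by (simp add: field_simps)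
    qed
    then have "ereal (norm xs / norm ys) * ereal (norm ys) \<le> \<kappa> * ereal (norm ys)"
      using \<kappa> by (intro ereal_mult_right_mono) auto
    then show ?thesis using False by simp
  qed
next
  assume bound: "\<forall>\<kappa>::ereal. aubin_exact C F xb yb \<le> \<kappa> \<longrightarrow>
       (\<forall>ys. \<forall>xs \<in> lim_coderivative C F xb yb ys. ereal (norm xs) \<le> \<kappa> * ereal (norm ys))"
  have "xs = 0" if "xs \<in> lim_coderivative C F xb yb 0" for xs
    using bound[rule_format, of \<infinity>, OF _ that] by simp
  moreover have "0 \<in> lim_coderivative C F xb yb 0"
    using base by (rule zero_in_lim_coderivative_zero)
  ultimately show "aubin_property C F xb yb"
    using aubin_property_iff_coderivative_zero[where F = F, OF C base lc] by blast
qed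

(* kappa ranges over the extended reals, where \<infinity> * 0 = 0: if F lacks the Aubin property the exact
   constant is \<infinity>, and a real-valued kappa would make the inequality hold vacuously. *)
theorem theorem3:
  fixes C :: "(real ^ 'n) set"
    and F :: "real ^ 'n \<Rightarrow> (real ^ 'm) set"
    and xb :: "real ^ 'n" and yb :: "real ^ 'm"
  assumes "closed C" and "convex C"
    and "C \<subseteq> svdom F"
    and "xb \<in> C" and "yb \<in> F xb"
    and "locally_closed_around (gph F) (xb, yb)"
  shows "(aubin_property C F xb yb \<longleftrightarrow>
            (\<forall>\<kappa>::ereal. aubin_exact C F xb yb \<le> \<kappa> \<longrightarrow>
               (\<forall>ys. \<forall>xs \<in> lim_coderivative C F xb yb ys.
                  ereal (norm xs) \<le> \<kappa> * ereal (norm ys)))) \<and>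
         (aubin_property C F xb yb \<longleftrightarrow> lim_coderivative C F xb yb 0 = {0}) \<and>
         aubin_exact C F xb yb = sv_norm (lim_coderivative C F xb yb)"
  using aubin_property_iff_coderivative_bound[where F = F, OF assms(1,2,4-6)]
    aubin_property_iff_coderivative_zero[where F = F, OF assms(1,2,4-6)]
    aubin_exact_eq_sv_norm[where F = F, OF assms(1,2,4-6)]
  by blast

end
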